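(* Let $\mathcal{G}$ be a finite connected undirected weighted graph with scaled adjacency matrix $P$, and let $\pi=\{O_1,\ldots,O_r\}$ be an equitable partition of its vertices, with quotient matrix $\overline{P}\in\mathbb{R}^{r\times r}$, such that the reduced graph $\mathcal{G}_\pi$ is bipartite. Let $v_r$ be the eigenvector of $\overline{P}$ associated with its minimum eigenvalue $\lambda_r$ (the eigenvalues of $\overline{P}$ are real). Let $T:\mathcal{U}\to\mathbb{R}$, with $[0,\infty)\subset\mathcal{U}\subset\mathbb{R}$, be continuously differentiable, positive, bounded and decreasing, and let $u^*$ be its unique fixed point, $T(u^* )=u^*$. If $$|T'(u^* )|\,\lambda_r<-1,$$ then the equation $$z=\overline{P}\,\mathbf{T}_r(z),\qquad \mathbf{T}_r(z)=[T(z_1),\ldots,T(z_r)]^T,$$ has a solution $z=(z_1,\ldots,z_r)$ other than $z^*=u^*\mathbf{1}_r$, where $\mathbf{1}_r\in\mathbb{R}^r$ is the vector of ones.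
   Context: Contact graph: $\mathcal{G}=\mathcal{G}(V,E)$ is a finite, connected, undirected graph with $N$ vertices and symmetric nonnegative weights $w_{i,j}=w_{j,i}$, with $w_{i,j}=0$ exactly when $i,j$ are not adjacent. The node degrees are $d_i=\sum_j w_{i,j}$, which are positive. The scaled adjacency matrix is $P=(p_{ij})\in\mathbb{R}^{N\times N}$ with $p_{ij}=d_i^{-1}w_{i,j}$; it is nonnegative and row-stochastic. Equitable partition: a partition $\pi$ of $V$ into nonempty classes $O_1,\ldots,O_r$ is equitable if there exist numbers $\overline{p}_{ij}$, $i,j=1,\ldots,r$, such that $\sum_{v\in O_j}p_{uv}=\overline{p}_{ij}$ for all $u\in O_i$. The quotient matrix is $\overline{P}=(\overline{p}_{ij})\in\mathbb{R}^{r\times r}$. Reduced graph: $\mathcal{G}_\pi$ is the simple graph with vertex set $\{O_1,\ldots,O_r\}$ and edge set $\{(O_i,O_j): i\neq j,\ \overline{p}_{ij}\neq 0 \text{ or } \overline{p}_{ji}\neq 0\}$ (self-loops are omitted even if $\overline{p}_{ii}\neq 0$). *)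

theory Defs
  imports "HOL-Analysis.Analysis"
begin

text \<open>
  Contact graphs: the vertex set is the finite type \<open>'n\<close>, \<open>adj\<close> is the adjacency relation and
  \<open>w $ i $ j\<close> the weight of the edge between \<open>i\<close> and \<open>j\<close>. Self-loops are allowed but not required.
\<close>

definition degree :: "real^'n^'n \<Rightarrow> 'n::finite \<Rightarrow> real"
  where "degree w i = (\<Sum>j\<in>UNIV. w $ i $ j)"

definition contact_graph :: "('n::finite \<Rightarrow> 'n \<Rightarrow> bool) \<Rightarrow> real^'n^'n \<Rightarrow> bool"
  where "contact_graph adj w \<longleftrightarrow>
    symp adj \<and>
    (\<forall>i j. adj\<^sup>*\<^sup>* i j) \<and>
    (\<forall>i j. w $ i $ j = w $ j $ i) \<and>
    (\<forall>i j. w $ i $ j \<ge> 0) \<and>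
    (\<forall>i j. w $ i $ j = 0 \<longleftrightarrow> \<not> adj i j) \<and>
    (\<forall>i. degree w i > 0)"

definition scaled_adjacency :: "real^'n^'n \<Rightarrow> real^'n^'n::finite"
  where "scaled_adjacency w = (\<chi> i j. inverse (degree w i) * w $ i $ j)"

text \<open>
  A partition into \<open>r\<close> classes is given as a family \<open>cls\<close> indexed by a finite type \<open>'r\<close> with
  \<open>CARD('r) = r\<close>; injectivity says that distinct indices name distinct (hence disjoint) classes.
\<close>

definition indexed_partition :: "('r::finite \<Rightarrow> 'n set) \<Rightarrow> bool"
  where "indexed_partition cls \<longleftrightarrow> partition_on UNIV (range cls) \<and> inj cls"

text \<open>
  The matrix \<open>Q\<close> satisfying this for a given partition is unique, since the classes are nonempty.
\<close>

definition quotient_matrix ::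
  "real^'n^'n \<Rightarrow> ('r::finite \<Rightarrow> 'n::finite set) \<Rightarrow> real^'r^'r \<Rightarrow> bool"
  where "quotient_matrix P cls Q \<longleftrightarrow>
    (\<forall>i j. \<forall>u\<in>cls i. (\<Sum>v\<in>cls j. P $ u $ v) = Q $ i $ j)"

definition equitable_partition ::
  "real^'n^'n \<Rightarrow> ('r::finite \<Rightarrow> 'n::finite set) \<Rightarrow> bool"
  where "equitable_partition P cls \<longleftrightarrow>
    indexed_partition cls \<and> (\<exists>Q. quotient_matrix P cls Q)"

text \<open>
  Adjacency in the reduced graph, where the index \<open>i\<close> stands for the \<open>i\<close>-th class.
\<close>

definition reduced_adj :: "real^'r^'r \<Rightarrow> 'r::finite \<Rightarrow> 'r \<Rightarrow> bool"
  where "reduced_adj Q i j \<longleftrightarrow> i \<noteq> j \<and> (Q $ i $ j \<noteq> 0 \<or> Q $ j $ i \<noteq> 0)"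

definition bipartite :: "('a \<Rightarrow> 'a \<Rightarrow> bool) \<Rightarrow> bool"
  where "bipartite adj \<longleftrightarrow> (\<exists>A B. A \<union> B = UNIV \<and> A \<inter> B = {} \<and>
    (\<forall>i j. adj i j \<longrightarrow> (i \<in> A \<and> j \<in> B) \<or> (i \<in> B \<and> j \<in> A)))"

definition eigenvector :: "'a::field^'n^'n::finite \<Rightarrow> 'a \<Rightarrow> 'a^'n \<Rightarrow> bool"
  where "eigenvector A k v \<longleftrightarrow> v \<noteq> 0 \<and> A *v v = k *s v"

definition eigenvalue :: "'a::field^'n^'n::finite \<Rightarrow> 'a \<Rightarrow> bool"
  where "eigenvalue A k \<longleftrightarrow> (\<exists>v. eigenvector A k v)"

text \<open>
  The minimum is over the real eigenvalues; for the quotient matrices considered here these are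
  all the complex eigenvalues, which is part of the claim of the theorem.
\<close>

definition min_eigenvalue :: "real^'n^'n::finite \<Rightarrow> real \<Rightarrow> bool"
  where "min_eigenvalue A k \<longleftrightarrow> eigenvalue A k \<and> (\<forall>m. eigenvalue A m \<longrightarrow> k \<le> m)"

text \<open>
  \<open>T'\<close> is a derivative of \<open>T\<close> relative to the set \<open>U\<close>, continuous on \<open>U\<close>. At every interior point
  of \<open>U\<close> it is the usual derivative.
\<close>

definition C1_on_with :: "real set \<Rightarrow> (real \<Rightarrow> real) \<Rightarrow> (real \<Rightarrow> real) \<Rightarrow> bool"
  where "C1_on_with U T T' \<longleftrightarrow>
    (\<forall>x\<in>U. (T has_real_derivative T' x) (at x within U)) \<and> continuous_on U T'"

end

theory Submission
  imports Defs
begin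

text \<open>
  Reverse the order on the coordinates of one side of the bipartition. Since \<open>T\<close> is decreasing,
  every off-diagonal entry of \<open>Pbar\<close> then contributes monotonically to \<open>z \<mapsto> Pbar *v T z\<close>, and a
  step of size \<open>1/(1+L)\<close> towards this image, \<open>L\<close> a Lipschitz constant of \<open>T\<close>, absorbs the
  diagonal entries. Flipping the signs of the absolute values of the minimal eigenvector gives a
  direction in which the linearisation at the constant solution expands, so a point slightly off
  the constant solution is a subsolution, and the monotone iteration started there converges to
  a solution above it.
\<close>

section \<open>The quotient matrix: stochastic, symmetrizable, with real spectrum\<close>

lemma quotient_matrix_row_sum:
  fixes w :: "real^'n::finite^'n" and cls :: "'r::finite \<Rightarrow> 'n set"
  assumes G: "contact_graph adj w" and part: "indexed_partition cls"
    and Q: "quotient_matrix (scaled_adjacency w) cls Q"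
  shows "(\<Sum>j\<in>UNIV. Q $ i $ j) = 1"
proof -
  have disj: "\<forall>i\<in>UNIV. \<forall>j\<in>UNIV. i \<noteq> j \<longrightarrow> cls i \<inter> cls j = {}"
    using part unfolding indexed_partition_def partition_on_def
    by (metis disjointD injD rangeI)
  have un: "(\<Union>j. cls j) = UNIV"
    using part unfolding indexed_partition_def by (simp add: partition_on_def)
  obtain u where u: "u \<in> cls i"
    using part unfolding indexed_partition_def partition_on_def by (metis ex_in_conv rangeI)
  have "(\<Sum>j\<in>UNIV. Q $ i $ j) = (\<Sum>j\<in>UNIV. \<Sum>v\<in>cls j. scaled_adjacency w $ u $ v)"
    using Q u unfolding quotient_matrix_def by simp
  also have "\<dots> = (\<Sum>v\<in>(\<Union>j. cls j). scaled_adjacency w $ u $ v)"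
    by (rule sum.UNION_disjoint [symmetric]) (use disj in auto)
  also have "\<dots> = inverse (degree w u) * degree w u"
    by (simp add: un scaled_adjacency_def degree_def sum_distrib_left)
  also have "\<dots> = 1"
    using G unfolding contact_graph_def by (metis left_inverse less_irrefl)
  finally show ?thesis .
qed

lemma quotient_matrix_nonneg:
  fixes w :: "real^'n::finite^'n" and cls :: "'r::finite \<Rightarrow> 'n set"
  assumes G: "contact_graph adj w" and part: "indexed_partition cls"
    and Q: "quotient_matrix (scaled_adjacency w) cls Q"
  shows "Q $ i $ j \<ge> 0"
proof -
  obtain u where u: "u \<in> cls i"
    using part unfolding indexed_partition_def partition_on_def by (metis ex_in_conv rangeI)
  have "Q $ i $ j = (\<Sum>v\<in>cls j. scaled_adjacency w $ u $ v)"
    using Q u unfolding quotient_matrix_def by simp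
  also have "\<dots> \<ge> 0"
    using G unfolding contact_graph_def scaled_adjacency_def
    by (auto intro!: sum_nonneg mult_nonneg_nonneg simp: less_imp_le)
  finally show ?thesis .
qed

text \<open>This is detailed balance for the lumped random walk. If class \<open>i\<close> is
  weighted by its total degree, \<open>m i * Q $ i $ j\<close> becomes the total edge weight between
  classes \<open>i\<close> and \<open>j\<close>, which inherits the symmetry of
  \<open>w\<close>.\<close>

lemma quotient_matrix_symmetrizable:
  fixes w :: "real^'n::finite^'n" and cls :: "'r::finite \<Rightarrow> 'n set"
  assumes G: "contact_graph adj w" and part: "indexed_partition cls"
    and Q: "quotient_matrix (scaled_adjacency w) cls Q"
  obtains m :: "'r \<Rightarrow> real"
  where "\<And>i. m i > 0" "\<And>i j. m i * Q $ i $ j = m j * Q $ j $ i"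
proof
  define m where "m i = (\<Sum>u\<in>cls i. degree w u)" for i
  have d: "degree w u > 0" for u
    using G unfolding contact_graph_def by blast
  have ne: "cls i \<noteq> {}" for i
    using part unfolding indexed_partition_def partition_on_def by (metis rangeI)
  show "m i > 0" for i
    unfolding m_def using d ne by (intro sum_pos) auto
  have mQ: "m i * Q $ i $ j = (\<Sum>u\<in>cls i. \<Sum>v\<in>cls j. w $ u $ v)" for i j
  proof -
    have "m i * Q $ i $ j = (\<Sum>u\<in>cls i. degree w u * (\<Sum>v\<in>cls j. scaled_adjacency w $ u $ v))"
      using Q unfolding m_def quotient_matrix_def by (simp add: sum_distrib_right)
    also have "\<dots> = (\<Sum>u\<in>cls i. \<Sum>v\<in>cls j. w $ u $ v)"
    proof (rule sum.cong [OF refl])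
      fix u
      have "degree w u \<noteq> 0" using d [of u] by simp
      then show "degree w u * (\<Sum>v\<in>cls j. scaled_adjacency w $ u $ v) = (\<Sum>v\<in>cls j. w $ u $ v)"
        by (simp add: scaled_adjacency_def sum_distrib_left field_simps)
    qed
    finally show ?thesis .
  qed
  show "m i * Q $ i $ j = m j * Q $ j $ i" for i j
  proof -
    have "(\<Sum>u\<in>cls i. \<Sum>v\<in>cls j. w $ u $ v) = (\<Sum>v\<in>cls j. \<Sum>u\<in>cls i. w $ u $ v)"
      by (rule sum.swap)
    also have "\<dots> = (\<Sum>v\<in>cls j. \<Sum>u\<in>cls i. w $ v $ u)"
      using G unfolding contact_graph_def by (metis (no_types, lifting) sum.cong)
    finally show ?thesis by (simp add: mQ)
  qed
qed

text \<open>\<open>Q\<close> is self-adjoint for the inner product weighted by \<open>m\<close>, so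
  the usual Rayleigh quotient argument applies: the form \<open>S\<close> is real, and it equals
  \<open>k\<close> times the positive weighted norm \<open>n\<close> of the eigenvector.\<close>

lemma symmetrizable_eigenvalue_real:
  fixes Q :: "real^'r::finite^'r"
  assumes pos: "\<And>i. m i > 0" and sym: "\<And>i j. m i * Q $ i $ j = m j * Q $ j $ i"
    and ev: "eigenvalue (map_matrix complex_of_real Q) k"
  shows "k \<in> \<real>"
proof -
  obtain v where v0: "v \<noteq> 0" and v: "map_matrix complex_of_real Q *v v = k *s v"
    using ev unfolding eigenvalue_def eigenvector_def by blast
  have vi: "(\<Sum>j\<in>UNIV. of_real (Q $ i $ j) * v $ j) = k * v $ i" for i
    using arg_cong [OF v, of "\<lambda>x. x $ i"]
    by (simp add: matrix_vector_mult_def map_matrix_def)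
  define S where "S = (\<Sum>i\<in>UNIV. \<Sum>j\<in>UNIV. of_real (m i * Q $ i $ j) * (cnj (v $ i) * v $ j))"
  define n where "n = (\<Sum>i\<in>UNIV. m i * (cmod (v $ i))\<^sup>2)"
  \<comment> \<open>Conjugation exchanges the two factors of each product. Exchanging the summation
    indices and using the symmetry of \<open>m i * Q $ i $ j\<close> restores
    \<open>S\<close>.\<close>
  have "cnj S = (\<Sum>i\<in>UNIV. \<Sum>j\<in>UNIV. of_real (m i * Q $ i $ j) * (v $ i * cnj (v $ j)))"
    by (simp add: S_def)
  also have "\<dots> = (\<Sum>j\<in>UNIV. \<Sum>i\<in>UNIV. of_real (m i * Q $ i $ j) * (v $ i * cnj (v $ j)))"
    by (rule sum.swap)
  also have "\<dots> = S"
    unfolding S_def by (intro sum.cong refl) (metis sym mult.commute)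
  finally have "S \<in> \<real>" by (simp add: Reals_cnj_iff)
  have "S = (\<Sum>i\<in>UNIV. of_real (m i) * cnj (v $ i) * (\<Sum>j\<in>UNIV. of_real (Q $ i $ j) * v $ j))"
    by (simp add: S_def sum_distrib_left mult_ac)
  also have "\<dots> = k * of_real n"
    unfolding vi n_def of_real_sum sum_distrib_left
    by (intro sum.cong refl) (simp add: complex_norm_square [symmetric] mult_ac)
  finally have S: "S = k * of_real n" .
  obtain l where l: "v $ l \<noteq> 0"
    using v0 by (metis vec_eq_iff zero_index)
  have "n > 0"
    unfolding n_def by (rule sum_pos2 [of _ l]) (use pos l in \<open>auto simp: less_imp_le\<close>)
  then have "k = S / of_real n"
    by (simp add: S)
  then show ?thesis
    using \<open>S \<in> \<real>\<close> by simp
qed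

section \<open>Monotone iteration in a signed order\<close>

text \<open>The sign of \<open>s i\<close> orients coordinate \<open>i\<close>. Started at a
  subsolution, the iterates of \<open>M\<close> increase in the resulting product order and stay in
  a compact set, so they converge coordinatewise; by continuity the limit is a fixed point.\<close>

lemma signed_monotone_fixed_point:
  fixes M :: "real^'r::finite \<Rightarrow> real^'r" and s :: "'r \<Rightarrow> real"
  assumes s: "\<And>i. s i \<noteq> 0" and B: "compact B" and cont: "continuous_on B M"
    and into: "M \<in> B \<rightarrow> B"
    and mono: "\<And>x y i. x \<in> B \<Longrightarrow> y \<in> B \<Longrightarrow> (\<And>i. s i * x $ i \<le> s i * y $ i)
      \<Longrightarrow> s i * M x $ i \<le> s i * M y $ i"
    and z0: "z0 \<in> B" "\<And>i. s i * z0 $ i \<le> s i * M z0 $ i"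
  obtains z where "z \<in> B" "M z = z" "\<And>i. s i * z0 $ i \<le> s i * z $ i"
proof -
  define X where "X n = (M ^^ n) z0" for n
  have XS: "X (Suc n) = M (X n)" and X0: "X 0 = z0" for n
    by (simp_all add: X_def)
  have XB: "X n \<in> B" for n
    by (induction n) (use z0 into in \<open>auto simp: XS X0\<close>)
  have "s i * X n $ i \<le> s i * X (Suc n) $ i" for n i
  proof (induction n arbitrary: i)
    case 0
    then show ?case using z0 by (simp add: X0 XS)
  next
    case (Suc n)
    then show ?case using mono [OF XB XB] XS by metis
  qed
  then have inc: "incseq (\<lambda>n. s i * X n $ i)" for i
    by (rule incseq_SucI)
  obtain C where C: "\<And>x. x \<in> B \<Longrightarrow> norm x \<le> C"
    using compact_imp_bounded [OF B] unfolding bounded_iff by blast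
  have bnd: "s i * X n $ i \<le> \<bar>s i\<bar> * C" for i n
  proof -
    have "s i * X n $ i \<le> \<bar>s i\<bar> * \<bar>X n $ i\<bar>"
      by (metis abs_ge_self abs_mult)
    also have "\<dots> \<le> \<bar>s i\<bar> * C"
      using C [OF XB] component_le_norm_cart order_trans by (blast intro: mult_left_mono abs_ge_zero)
    finally show ?thesis .
  qed
  have "\<exists>l. (\<lambda>n. s i * X n $ i) \<longlonglongrightarrow> l" for i
    using incseq_convergent [OF inc] bnd by metis
  then obtain l where l: "\<And>i. (\<lambda>n. s i * X n $ i) \<longlonglongrightarrow> l i"
    by metis
  define z :: "real^'r" where "z = (\<chi> i. l i / s i)"
  have Xz: "X \<longlonglongrightarrow> z"
  proof (rule vec_tendstoI)
    fix i
    have "(\<lambda>n. (s i * X n $ i) / s i) \<longlonglongrightarrow> l i / s i"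
      by (intro tendsto_divide l tendsto_const s)
    then show "(\<lambda>n. X n $ i) \<longlonglongrightarrow> z $ i"
      using s by (simp add: z_def)
  qed
  have zB: "z \<in> B"
    using closed_sequentially [OF compact_imp_closed [OF B]] XB Xz by blast
  have "(\<lambda>n. M (X n)) \<longlonglongrightarrow> M z"
    using continuous_on_tendsto_compose [OF cont Xz zB] XB by simp
  moreover have "(\<lambda>n. M (X n)) \<longlonglongrightarrow> z"
    using LIMSEQ_Suc [OF Xz] by (simp add: XS)
  ultimately have "M z = z"
    by (rule LIMSEQ_unique)
  moreover have "s i * z0 $ i \<le> s i * z $ i" for i
    using incseq_le [OF inc l, of i 0] s by (simp add: X0 z_def)
  ultimately show thesis
    using that zB by blast
qed

text \<open>The plain map \<open>F\<close> need not be monotone in the signed order, because a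
  positive diagonal entry couples a coordinate to itself through the decreasing \<open>T\<close>.
  The damped map \<open>M\<close> has the same fixed points and is monotone.\<close>

lemma signed_subsolution_imp_solution:
  fixes Q :: "real^'r::finite^'r" and s :: "'r \<Rightarrow> real" and T :: "real \<Rightarrow> real"
  assumes Q: "\<And>i j. Q $ i $ j \<ge> 0" "\<And>i. (\<Sum>j\<in>UNIV. Q $ i $ j) = 1"
    and s: "\<And>i. s i = 1 \<or> s i = -1" "\<And>i j. i \<noteq> j \<Longrightarrow> Q $ i $ j \<noteq> 0 \<Longrightarrow> s j = - s i"
    and anti: "antimono_on {0..C} T" and range: "T \<in> {0..C} \<rightarrow> {0..C}"
    and lip: "L-lipschitz_on {0..C} T"
    and z0: "\<And>i. z0 $ i \<in> {0..C}"
      "\<And>i. s i * z0 $ i \<le> s i * (\<Sum>j\<in>UNIV. Q $ i $ j * T (z0 $ j))"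
  obtains z where "\<And>i. z $ i \<in> {0..C}" "z = Q *v (\<chi> i. T (z $ i))"
    "\<And>i. s i * z0 $ i \<le> s i * z $ i"
proof -
  define B :: "(real^'r) set" where "B = {z. \<forall>i. z $ i \<in> {0..C}}"
  have B_cbox: "B = cbox 0 (\<chi> i. C)"
    by (auto simp: B_def mem_box_cart)
  then have B: "compact B" by (simp only: compact_cbox)
  have L: "L \<ge> 0" using lip by (rule lipschitz_on_nonneg)
  \<comment> \<open>With this step size \<open>1 - e = e * L\<close>: the gain
    \<open>(1 - e) * d\<close> from the identity part of \<open>M\<close> exactly covers the largest
    possible loss \<open>e * L * d\<close> from the diagonal entry.\<close>
  define e where "e = 1 / (1 + L)"
  have e: "0 < e" "e \<le> 1" "1 - e = e * L"
    using L by (auto simp: e_def field_simps)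
  define F :: "real^'r \<Rightarrow> real^'r" where "F z = (\<chi> i. \<Sum>j\<in>UNIV. Q $ i $ j * T (z $ j))" for z
  define M where "M z = (1 - e) *\<^sub>R z + e *\<^sub>R F z" for z
  have Mi: "M z $ i = (1 - e) * z $ i + e * (\<Sum>j\<in>UNIV. Q $ i $ j * T (z $ j))" for z i
    by (simp add: M_def F_def)
  have "continuous_on B (\<lambda>z. T (z $ j))" for j
    by (rule continuous_on_compose2 [OF lipschitz_on_continuous_on [OF lip]])
      (auto simp: B_def intro!: continuous_intros)
  then have cont: "continuous_on B M"
    unfolding M_def F_def by (intro continuous_intros)
  \<comment> \<open>The rows of \<open>Q\<close> are stochastic, so each coordinate of
    \<open>F z\<close> is a weighted average of values of \<open>T\<close>.\<close>
  have FB: "F z \<in> B" if "z \<in> B" for z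
  proof -
    have T: "0 \<le> T (z $ j)" "T (z $ j) \<le> C" for j
      using that range by (auto simp: B_def Pi_iff)
    have "(\<Sum>j\<in>UNIV. Q $ i $ j * T (z $ j)) \<le> (\<Sum>j\<in>UNIV. Q $ i $ j * C)" for i
      by (intro sum_mono mult_left_mono T Q)
    moreover have "(\<Sum>j\<in>UNIV. Q $ i $ j * C) = C" for i
      by (simp add: Q sum_distrib_right [symmetric])
    ultimately show ?thesis
      using T Q by (auto simp: B_def F_def intro!: sum_nonneg)
  qed
  have into: "M \<in> B \<rightarrow> B"
  proof
    fix z assume z: "z \<in> B"
    have "convex B" unfolding B_cbox by (rule convex_box)
    then show "M z \<in> B"
      unfolding M_def using z FB [OF z] e by (intro convexD) auto
  qed
  have mono: "s i * M x $ i \<le> s i * M y $ i"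
    if x: "x \<in> B" and y: "y \<in> B" and le: "\<And>i. s i * x $ i \<le> s i * y $ i" for x y i
  proof -
    define d where "d = s i * (y $ i - x $ i)"
    have d: "d = \<bar>y $ i - x $ i\<bar>"
      using le [of i] s(1) [of i] by (auto simp: d_def)
    have xy: "x $ j \<in> {0..C}" "y $ j \<in> {0..C}" for j
      using x y by (auto simp: B_def)
    \<comment> \<open>Only the diagonal term can be negative, and the Lipschitz bound together with
      \<open>Q $ i $ i \<le> 1\<close> limits it. A nonzero off-diagonal entry joins coordinates of
      opposite orientation, and the antitone \<open>T\<close> reverses the order once more, so its
      contribution is nonnegative.\<close>
    have bound: "(if j = i then - L * d else 0) \<le> Q $ i $ j * (s i * (T (y $ j) - T (x $ j)))" for j
    proof (cases "j = i")
      case True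
      have "\<bar>T (y $ i) - T (x $ i)\<bar> \<le> L * d"
        using lipschitz_onD [OF lip xy(2) xy(1), of i i] by (simp add: dist_real_def d)
      then have "- (L * d) \<le> s i * (T (y $ i) - T (x $ i))"
        using s(1) [of i] by auto
      then have "Q $ i $ i * (- (L * d)) \<le> Q $ i $ i * (s i * (T (y $ i) - T (x $ i)))"
        by (intro mult_left_mono Q)
      moreover have "Q $ i $ i \<le> 1"
        using member_le_sum [of i UNIV "\<lambda>j. Q $ i $ j"] Q by simp
      then have "Q $ i $ i * (L * d) \<le> L * d"
        using L d by (intro mult_left_le_one_le) (auto simp: Q)
      ultimately show ?thesis using True by simp
    next
      case False
      show ?thesis
      proof (cases "Q $ i $ j = 0")
        case nz: False
        have "s i * (T (y $ j) - T (x $ j)) \<ge> 0"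
          using s(2) [OF False [symmetric] nz] s(1) [of i] le [of j]
            monotone_onD [OF anti xy(1) xy(2), of j j] monotone_onD [OF anti xy(2) xy(1), of j j]
          by auto
        then show ?thesis using False Q by simp
      qed (use False in auto)
    qed
    have "- L * d = (\<Sum>j\<in>UNIV. if j = i then - L * d else 0)"
      by simp
    also have "\<dots> \<le> (\<Sum>j\<in>UNIV. Q $ i $ j * (s i * (T (y $ j) - T (x $ j))))"
      by (intro sum_mono bound)
    finally have "- L * d \<le> s i * ((\<Sum>j\<in>UNIV. Q $ i $ j * T (y $ j)) - (\<Sum>j\<in>UNIV. Q $ i $ j * T (x $ j)))"
      (is "_ \<le> ?D") by (simp add: sum_distrib_left sum_subtractf algebra_simps)
    then have "e * (- L * d) \<le> e * ?D"
      using e by (intro mult_left_mono) auto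
    moreover have "s i * M y $ i - s i * M x $ i = (1 - e) * d + e * ?D"
      by (simp add: Mi d_def algebra_simps)
    ultimately show ?thesis using e(3) by (simp add: algebra_simps)
  qed
  \<comment> \<open>\<open>M z0\<close> lies on the segment from \<open>z0\<close> to
    \<open>F z0\<close>, so a subsolution for \<open>F\<close> is one for \<open>M\<close>.\<close>
  have start: "s i * z0 $ i \<le> s i * M z0 $ i" for i
    using mult_left_mono [OF z0(2) less_imp_le [OF e(1)], of i]
    by (simp add: Mi algebra_simps)
  have "z0 \<in> B" using z0(1) by (simp add: B_def)
  moreover have "s i \<noteq> 0" for i using s(1) [of i] by auto
  ultimately obtain z where z: "z \<in> B" "M z = z" "\<And>i. s i * z0 $ i \<le> s i * z $ i"
    using signed_monotone_fixed_point [of s B M z0] B cont into mono start by blast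
  have "e *\<^sub>R F z = e *\<^sub>R z"
    using z(2) unfolding M_def by (simp add: algebra_simps)
  then have "z = F z"
    using e by simp
  then have "z = Q *v (\<chi> i. T (z $ i))"
    by (simp add: F_def matrix_vector_mult_def)
  then show thesis
    using that z by (auto simp: B_def)
qed

section \<open>An expanding direction at the constant solution\<close>

text \<open>With alternating signs the off-diagonal terms all add up with the same sign, to
  \<open>- R\<close>. In the eigenvector equation for \<open>v\<close> cancellation may occur among
  them, so the triangle inequality bounds \<open>R\<close> from below by
  \<open>(Q $ i $ i - k)\<close> times the absolute value of \<open>v $ i\<close>.\<close>

lemma sign_flipped_eigenvector_expands:
  fixes Q :: "real^'r::finite^'r" and s :: "'r \<Rightarrow> real"
  assumes Q: "\<And>i j. Q $ i $ j \<ge> 0"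
    and s: "\<And>i. s i = 1 \<or> s i = -1" "\<And>i j. i \<noteq> j \<Longrightarrow> Q $ i $ j \<noteq> 0 \<Longrightarrow> s j = - s i"
    and ev: "Q *v v = k *s v" and k: "k \<le> 0"
  shows "s i * (\<Sum>j\<in>UNIV. Q $ i $ j * (s j * \<bar>v $ j\<bar>)) \<le> k * \<bar>v $ i\<bar>"
proof -
  define R where "R = (\<Sum>j\<in>UNIV-{i}. Q $ i $ j * \<bar>v $ j\<bar>)"
  have split: "sum f UNIV = f i + sum f (UNIV - {i})" for f :: "'r \<Rightarrow> real"
    by (simp add: sum.remove)
  have "s i * (Q $ i $ j * (s j * \<bar>v $ j\<bar>)) = - (Q $ i $ j * \<bar>v $ j\<bar>)" if "j \<noteq> i" for j
    using s(2) [of i j] s(1) [of i] that by (cases "Q $ i $ j = 0") auto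
  then have "(\<Sum>j\<in>UNIV-{i}. s i * (Q $ i $ j * (s j * \<bar>v $ j\<bar>))) = - R"
    unfolding R_def sum_negf [symmetric] by (intro sum.cong) auto
  moreover have "s i * (Q $ i $ i * (s i * \<bar>v $ i\<bar>)) = Q $ i $ i * \<bar>v $ i\<bar>"
    using s(1) [of i] by auto
  ultimately have "s i * (\<Sum>j\<in>UNIV. Q $ i $ j * (s j * \<bar>v $ j\<bar>)) = Q $ i $ i * \<bar>v $ i\<bar> - R"
    unfolding sum_distrib_left by (subst split) simp
  moreover have "(\<Sum>j\<in>UNIV. Q $ i $ j * v $ j) = k * v $ i"
    using arg_cong [OF ev, of "\<lambda>x. x $ i"] by (simp add: matrix_vector_mult_def)
  then have "(k - Q $ i $ i) * v $ i = (\<Sum>j\<in>UNIV-{i}. Q $ i $ j * v $ j)"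
    unfolding split by (simp add: algebra_simps)
  then have "\<bar>k - Q $ i $ i\<bar> * \<bar>v $ i\<bar> = \<bar>\<Sum>j\<in>UNIV-{i}. Q $ i $ j * v $ j\<bar>"
    by (metis abs_mult)
  then have "\<bar>k - Q $ i $ i\<bar> * \<bar>v $ i\<bar> \<le> R"
    using sum_abs [of "\<lambda>j. Q $ i $ j * v $ j" "UNIV-{i}"] Q
    by (simp add: R_def abs_mult)
  \<comment> \<open>The absolute value opens this way because
    \<open>k \<le> 0 \<le> Q $ i $ i\<close>.\<close>
  then have "(Q $ i $ i - k) * \<bar>v $ i\<bar> \<le> R"
    using Q [of i i] k by simp
  ultimately show ?thesis by (simp add: algebra_simps)
qed

text \<open>Coordinates with \<open>v $ i \<noteq> 0\<close> satisfy the inequality to first order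
  with strict sign. Where \<open>v $ i = 0\<close> the first-order term may vanish, and monotonicity
  of \<open>T\<close> is used instead. Finitely many coordinates allow a common range of
  \<open>h\<close>.\<close>

lemma signed_subsolution_near_constant:
  fixes Q :: "real^'r::finite^'r" and s :: "'r \<Rightarrow> real" and T :: "real \<Rightarrow> real"
  assumes Q: "\<And>i j. Q $ i $ j \<ge> 0" "\<And>i. (\<Sum>j\<in>UNIV. Q $ i $ j) = 1"
    and s: "\<And>i. s i = 1 \<or> s i = -1" "\<And>i j. i \<noteq> j \<Longrightarrow> Q $ i $ j \<noteq> 0 \<Longrightarrow> s j = - s i"
    and anti: "antimono_on {0..C} T" and u: "0 < u" "u < C" "T u = u"
    and der: "(T has_real_derivative D) (at u)" and D: "D \<le> 0"
    and ev: "Q *v v = k *s v" and k: "\<bar>D\<bar> * k < -1"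
  shows "\<forall>\<^sub>F h in at_right 0. \<forall>i. u + h * (s i * \<bar>v $ i\<bar>) \<in> {0..C} \<and>
    s i * (u + h * (s i * \<bar>v $ i\<bar>)) \<le> s i * (\<Sum>j\<in>UNIV. Q $ i $ j * T (u + h * (s j * \<bar>v $ j\<bar>)))"
proof -
  define a where "a i = s i * \<bar>v $ i\<bar>" for i
  have ss: "s i * s i = 1" for i using s(1) [of i] by auto
  have k0: "k \<le> 0"
    using k by (metis abs_ge_zero mult_nonneg_nonneg not_one_le_zero less_le_trans linear
        neg_0_le_iff_le not_less)
  have "((\<lambda>h. u + h * a i) \<longlongrightarrow> u + 0 * a i) (at_right 0)" for i
    by (intro tendsto_intros)
  then have "\<forall>\<^sub>F h in at_right 0. u + h * a i \<in> {0<..<C}" for i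
    by (rule topological_tendstoD) (use u in auto)
  then have in_box: "\<forall>\<^sub>F h in at_right 0. \<forall>i. u + h * a i \<in> {0<..<C}"
    by (rule eventually_all_finite)
  have "\<forall>\<^sub>F h in at_right 0. s i * (u + h * a i) \<le> s i * (\<Sum>j\<in>UNIV. Q $ i $ j * T (u + h * a j))"
    for i
  proof (cases "v $ i = 0")
    \<comment> \<open>Coordinate \<open>i\<close> itself stays at \<open>u\<close>. Its neighbours
      move against the orientation of \<open>i\<close>, so the antitone \<open>T\<close> pushes
      their values in the direction of \<open>s i\<close>.\<close>
    case True
    have "\<forall>\<^sub>F h in at_right (0::real). 0 < h"
      by (simp add: eventually_at_right_less)
    then show ?thesis
      using in_box
    proof eventually_elim
      case (elim h)
      have "0 \<le> Q $ i $ j * (s i * (T (u + h * a j) - u))" for j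
      proof (cases "i = j \<or> Q $ i $ j = 0")
        case False
        then have sj: "s j = - s i" using s(2) by blast
        have b: "u \<in> {0..C}" "u + h * a j \<in> {0..C}"
          using u elim(2) by (auto simp: less_imp_le)
        have "0 \<le> h * \<bar>v $ j\<bar>" using elim by simp
        then have "0 \<le> s i * (T (u + h * a j) - u)"
          using s(1) [of i] sj monotone_onD [OF anti b] monotone_onD [OF anti b(2) b(1)] u(3)
          by (auto simp: a_def)
        then show ?thesis using Q by simp
      qed (use True u in \<open>auto simp: a_def\<close>)
      then have "0 \<le> (\<Sum>j\<in>UNIV. Q $ i $ j * (s i * (T (u + h * a j) - u)))"
        by (intro sum_nonneg)
      also have "\<dots> = s i * (\<Sum>j\<in>UNIV. Q $ i $ j * T (u + h * a j)) - s i * (u * (\<Sum>j\<in>UNIV. Q $ i $ j))"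
        by (simp add: sum_distrib_left sum_subtractf algebra_simps)
      finally show ?case using True by (simp add: a_def Q)
    qed
  next
    case False
    \<comment> \<open>\<open>g\<close> is the signed excess of the right side over the left. It
      vanishes at \<open>h = 0\<close> because \<open>T u = u\<close> and the rows sum to one, so a
      positive derivative there suffices.\<close>
    define g where "g h = s i * ((\<Sum>j\<in>UNIV. Q $ i $ j * T (u + h * a j)) - (u + h * a i))" for h
    have lin: "((\<lambda>h. u + h * c) has_real_derivative c) (at 0)" for c
      by (auto intro!: derivative_eq_intros)
    have derT: "((\<lambda>h. T (u + h * c)) has_real_derivative D * c) (at 0)" for c
      by (rule DERIV_chain2 [where g = "\<lambda>h. u + h * c"])
        (use der lin in auto)
    have "(g has_real_derivative s i * ((\<Sum>j\<in>UNIV. Q $ i $ j * (D * a j)) - a i)) (at 0)"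
      unfolding g_def by (intro DERIV_cmult DERIV_diff DERIV_sum derT lin)
    moreover have "s i * ((\<Sum>j\<in>UNIV. Q $ i $ j * (D * a j)) - a i)
        = D * (s i * (\<Sum>j\<in>UNIV. Q $ i $ j * a j)) - \<bar>v $ i\<bar>"
    proof -
      have "(\<Sum>j\<in>UNIV. Q $ i $ j * (D * a j)) = D * (\<Sum>j\<in>UNIV. Q $ i $ j * a j)"
        by (simp add: sum_distrib_left mult_ac)
      moreover have "s i * a i = \<bar>v $ i\<bar>"
        using ss [of i] by (simp add: a_def mult.assoc [symmetric])
      ultimately show ?thesis by (simp add: right_diff_distrib)
    qed
    \<comment> \<open>Since \<open>D \<le> 0\<close>, the hypothesis on \<open>k\<close> says
      \<open>D * k > 1\<close>, and multiplying the eigenvector estimate by \<open>D\<close>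
      reverses it into the required lower bound.\<close>
    moreover have "\<bar>v $ i\<bar> < D * (s i * (\<Sum>j\<in>UNIV. Q $ i $ j * a j))"
    proof -
      have "\<bar>v $ i\<bar> < D * (k * \<bar>v $ i\<bar>)"
        using mult_strict_right_mono [OF k, of "\<bar>v $ i\<bar>"] False D by simp
      also have "\<dots> \<le> D * (s i * (\<Sum>j\<in>UNIV. Q $ i $ j * a j))"
        unfolding a_def
        by (intro mult_left_mono_neg D sign_flipped_eigenvector_expands Q s ev k0)
      finally show ?thesis .
    qed
    ultimately obtain D' where "(g has_real_derivative D') (at 0)" "0 < D'"
      by simp
    then have "\<exists>d>0. \<forall>h>0. h < d \<longrightarrow> g 0 < g (0 + h)"
      by (rule DERIV_pos_inc_right)
    then obtain d where d: "d > 0" "\<And>h. h > 0 \<Longrightarrow> h < d \<Longrightarrow> g 0 < g h"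
      by auto
    have "g 0 = 0"
      by (simp add: g_def u Q sum_distrib_right [symmetric])
    then have "0 < g h" if "0 < h" "h < d" for h using d that by metis
    then show ?thesis
      unfolding eventually_at_right_field g_def using d(1)
      by (intro exI [of _ d]) (force simp: right_diff_distrib)
  qed
  then have "\<forall>\<^sub>F h in at_right 0. \<forall>i.
      s i * (u + h * a i) \<le> s i * (\<Sum>j\<in>UNIV. Q $ i $ j * T (u + h * a j))"
    by (rule eventually_all_finite)
  with in_box show ?thesis
    unfolding a_def by eventually_elim (auto simp: less_imp_le)
qed

section \<open>Lipschitz constant and sign of the derivative of \<open>T\<close>\<close>

lemma C1_on_with_imp_lipschitz:
  assumes C1: "C1_on_with U T T'" and sub: "{a..b} \<subseteq> U"
  obtains L where "L-lipschitz_on {a..b} T"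
proof -
  have "continuous_on {a..b} T'"
    using C1 sub unfolding C1_on_with_def by (blast intro: continuous_on_subset)
  then have "bounded (T' ` {a..b})"
    by (intro compact_imp_bounded compact_continuous_image) auto
  then obtain L where L: "L > 0" "\<And>x. x \<in> {a..b} \<Longrightarrow> norm (T' x) \<le> L"
    unfolding bounded_pos by auto
  have der: "(T has_real_derivative T' x) (at x within {a..b})" if "x \<in> {a..b}" for x
    using C1 sub that unfolding C1_on_with_def by (meson DERIV_subset subsetD)
  have "norm (T x - T y) \<le> L * norm (x - y)" if "x \<in> {a..b}" "y \<in> {a..b}" for x y
    by (rule field_differentiable_bound [of "{a..b}" T T'])
      (use der L that in auto)
  then have "L-lipschitz_on {a..b} T"
    using L by (intro lipschitz_onI) (auto simp: dist_norm)
  then show thesis by (rule that)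
qed

lemma antimono_on_imp_deriv_nonpos:
  fixes T :: "real \<Rightarrow> real"
  assumes anti: "antimono_on A T" and x: "x \<in> interior A"
    and der: "(T has_real_derivative D) (at x)"
  shows "D \<le> 0"
proof (rule ccontr)
  assume "\<not> D \<le> 0"
  then obtain d where d: "d > 0" "\<And>h. h > 0 \<Longrightarrow> h < d \<Longrightarrow> T x < T (x + h)"
    using DERIV_pos_inc_right [OF der] by force
  obtain e where e: "e > 0" "ball x e \<subseteq> A"
    using x mem_interior by blast
  define h where "h = min d e / 2"
  have h: "0 < h" "h < d" "h < e" using d(1) e(1) by (auto simp: h_def)
  then have "x + h \<in> A" "x \<in> A"
    using e by (auto simp: dist_real_def subset_eq)
  then have "T (x + h) \<le> T x"
    using monotone_onD [OF anti] h by simp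
  with d(2) [OF h(1,2)] show False by simp
qed

section \<open>Real spectrum and a solution away from the constant one\<close>

theorem mainTheorem1:
  fixes adj :: "'n::finite \<Rightarrow> 'n \<Rightarrow> bool"
    and w P :: "real^'n^'n"
    and cls :: "'r::finite \<Rightarrow> 'n set"
    and Pbar :: "real^'r^'r"
    and lambda_r :: real
    and v_r :: "real^'r"
    and U :: "real set"
    and T T' :: "real \<Rightarrow> real"
    and ustar :: real
  assumes "contact_graph adj w"
    and "P = scaled_adjacency w"
    and "equitable_partition P cls"
    and "quotient_matrix P cls Pbar"
    and "bipartite (reduced_adj Pbar)"
    and "min_eigenvalue Pbar lambda_r"
    and "eigenvector Pbar lambda_r v_r"
    and "{0..} \<subseteq> U"
    and "C1_on_with U T T'"
    and "\<And>x. x \<in> U \<Longrightarrow> T x > 0"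
    and "bounded (T ` U)"
    and "antimono_on U T"
    and "ustar \<in> U" and "T ustar = ustar"
    and "\<And>x. x \<in> U \<Longrightarrow> T x = x \<Longrightarrow> x = ustar"
    and "\<bar>T' ustar\<bar> * lambda_r < -1"
  shows "(\<forall>m. eigenvalue (map_matrix complex_of_real Pbar) m \<longrightarrow> m \<in> \<real>) \<and>
    (\<exists>z::real^'r. (\<forall>i. z $ i \<in> U) \<and>
       z = Pbar *v (\<chi> i. T (z $ i)) \<and> z \<noteq> ustar *s 1)"
proof
  have part: "indexed_partition cls"
    using assms(3) by (simp add: equitable_partition_def)
  note Qm = assms(4) [unfolded assms(2)]
  show "\<forall>m. eigenvalue (map_matrix complex_of_real Pbar) m \<longrightarrow> m \<in> \<real>"
    using quotient_matrix_symmetrizable [OF assms(1) part Qm] symmetrizable_eigenvalue_real by metis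
  have Q: "Pbar $ i $ j \<ge> 0" "(\<Sum>j\<in>UNIV. Pbar $ i $ j) = 1" for i j
    using quotient_matrix_nonneg [OF assms(1) part Qm] quotient_matrix_row_sum [OF assms(1) part Qm]
    by auto
  obtain A B where AB: "A \<inter> B = {}"
      "\<And>i j. reduced_adj Pbar i j \<Longrightarrow> (i \<in> A \<and> j \<in> B) \<or> (i \<in> B \<and> j \<in> A)"
    using assms(5) unfolding bipartite_def by metis
  define s :: "'r \<Rightarrow> real" where "s i = (if i \<in> A then 1 else -1)" for i
  have s1: "s i = 1 \<or> s i = -1" for i by (simp add: s_def)
  \<comment> \<open>A nonzero off-diagonal entry is an edge of the reduced graph, hence crosses the
    bipartition.\<close>
  have s2: "s j = - s i" if "i \<noteq> j" "Pbar $ i $ j \<noteq> 0" for i j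
    using AB(1) AB(2) [of i j] that by (auto simp: s_def reduced_adj_def)
  obtain C0 where C0: "\<And>x. x \<in> U \<Longrightarrow> \<bar>T x\<bar> \<le> C0"
    using assms(11) unfolding bounded_iff by auto
  \<comment> \<open>The extra 1 puts \<open>ustar = T ustar\<close> strictly below \<open>C\<close>.
    Thus \<open>ustar\<close> is interior to the box and to \<open>U\<close>, where the relative
    derivative is two-sided.\<close>
  define C where "C = C0 + 1"
  have u: "0 < ustar" "ustar < C"
    using assms(10) [OF assms(13)] assms(14) C0 [OF assms(13)] by (auto simp: C_def)
  have CU: "{0..C} \<subseteq> U" using assms(8) by auto
  have range: "T \<in> {0..C} \<rightarrow> {0..C}"
    using CU assms(10) C0 by (force simp: C_def less_imp_le)
  have anti: "antimono_on {0..C} T"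
    using assms(12) CU by (rule monotone_on_subset)
  have "ustar \<in> {0<..<C}" using u by simp
  then have int: "ustar \<in> interior {0..C}" by simp
  have der: "(T has_real_derivative T' ustar) (at ustar)"
    using assms(9,13) at_within_interior [OF subsetD [OF interior_mono [OF CU] int]]
    unfolding C1_on_with_def by metis
  have D: "T' ustar \<le> 0"
    by (rule antimono_on_imp_deriv_nonpos [OF anti int der])
  obtain L where lip: "L-lipschitz_on {0..C} T"
    using C1_on_with_imp_lipschitz [OF assms(9) CU] .
  have v0: "v_r \<noteq> 0" and ev: "Pbar *v v_r = lambda_r *s v_r"
    using assms(7) by (auto simp: eigenvector_def)
  have "\<forall>\<^sub>F h in at_right (0::real). 0 < h"
    by (simp add: eventually_at_right_less)
  then have "\<forall>\<^sub>F h in at_right 0. 0 < h \<and> (\<forall>i. ustar + h * (s i * \<bar>v_r $ i\<bar>) \<in> {0..C} \<and>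
    s i * (ustar + h * (s i * \<bar>v_r $ i\<bar>))
      \<le> s i * (\<Sum>j\<in>UNIV. Pbar $ i $ j * T (ustar + h * (s j * \<bar>v_r $ j\<bar>))))"
    using signed_subsolution_near_constant [OF Q s1 s2 anti u assms(14) der D ev assms(16)]
    by (rule eventually_conj)
  from eventually_happens' [OF trivial_limit_at_right_real this]
  obtain h where h: "0 < h" "\<And>i. ustar + h * (s i * \<bar>v_r $ i\<bar>) \<in> {0..C}"
    "\<And>i. s i * (ustar + h * (s i * \<bar>v_r $ i\<bar>))
      \<le> s i * (\<Sum>j\<in>UNIV. Pbar $ i $ j * T (ustar + h * (s j * \<bar>v_r $ j\<bar>)))"
    by blast
  define z0 :: "real^'r" where "z0 = (\<chi> i. ustar + h * (s i * \<bar>v_r $ i\<bar>))"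
  have z0: "z0 $ i \<in> {0..C}"
    "s i * z0 $ i \<le> s i * (\<Sum>j\<in>UNIV. Pbar $ i $ j * T (z0 $ j))" for i
    using h by (auto simp: z0_def)
  obtain z where z: "\<And>i. z $ i \<in> {0..C}" "z = Pbar *v (\<chi> i. T (z $ i))"
      "\<And>i. s i * z0 $ i \<le> s i * z $ i"
    using signed_subsolution_imp_solution [OF Q s1 s2 anti range lip z0] by blast
  obtain l where l: "v_r $ l \<noteq> 0"
    using v0 by (metis vec_eq_iff zero_index)
  \<comment> \<open>In a coordinate where the eigenvector is nonzero the starting point is strictly
    beyond \<open>ustar\<close> in the signed order, and \<open>z\<close> lies at or above the
    starting point.\<close>
  have "s l * ustar < s l * z0 $ l"
    using h(1) l s1 [of l] by (auto simp: z0_def)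
  then have "z $ l \<noteq> ustar"
    using z(3) [of l] by auto
  then have "z \<noteq> ustar *s 1" by auto
  then show "\<exists>z::real^'r. (\<forall>i. z $ i \<in> U) \<and> z = Pbar *v (\<chi> i. T (z $ i)) \<and> z \<noteq> ustar *s 1"
    using z(1,2) CU by blast
qed

end
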